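(* A connected graph $G$ is $1$-stress regular if and only if it is isomorphic to the cycle $C_4$ or $C_5$.
   Context: Graphs are finite, undirected and simple. A geodesic is a shortest path between two vertices (a path and its reverse are the same geodesic); it passes through a vertex if that vertex is an internal vertex of it. The stress of a vertex is the number of geodesics in $G$ passing through it. A graph is $k$-stress regular if all of its vertices have stress $k$. $C_n$ is the cycle on $n$ vertices. *)

theory Defs
  imports "Graph_Theory.Graph_Theory"
begin

(* Finite simple undirected graphs are the library's finite, loop-free, symmetric digraphs
   without parallel arcs (locale predicate graph).  In such a graph a path is determined by its
   vertex sequence, so paths are vertex lists (vpath). *)

definition geodesic :: "'a vwalk \<Rightarrow> ('a, 'b) pre_digraph \<Rightarrow> bool" where
  "geodesic p G \<longleftrightarrow> vpath p G \<and>
     (\<forall>q. vpath q G \<and> hd q = hd p \<and> last q = last p \<longrightarrow> vwalk_length p \<le> vwalk_length q)"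

definition internal_verts :: "'a vwalk \<Rightarrow> 'a set" where
  "internal_verts p = set (butlast (tl p))"

(* A path and its reverse are the same geodesic: what is counted are the sets {p, rev p}. *)
definition stress :: "('a, 'b) pre_digraph \<Rightarrow> 'a \<Rightarrow> nat" where
  "stress G v = card {{p, rev p} | p. geodesic p G \<and> v \<in> internal_verts p}"

definition stress_regular :: "nat \<Rightarrow> ('a, 'b) pre_digraph \<Rightarrow> bool" where
  "stress_regular k G \<longleftrightarrow> (\<forall>v \<in> verts G. stress G v = k)"

(* The cycle on n vertices, meaningful for n \<ge> 3 only. *)
definition cycle_graph :: "nat \<Rightarrow> nat pair_pre_digraph" where
  "cycle_graph n = \<lparr> pverts = {..<n},
     parcs = {(u, v). u < n \<and> v < n \<and> (v = Suc u mod n \<or> u = Suc v mod n)} \<rparr>"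

lemma pair_graph_cycle_graph:
  assumes "n \<ge> 3"
  shows "pair_graph (cycle_graph n)"
proof
  have "parcs (cycle_graph n) \<subseteq> {..<n} \<times> {..<n}"
    by (auto simp: cycle_graph_def)
  then show "finite (parcs (cycle_graph n))"
    by (rule finite_subset) simp
next
  fix e assume "e \<in> parcs (cycle_graph n)"
  then show "fst e \<noteq> snd e"
    using assms by (auto simp: cycle_graph_def mod_Suc split: if_splits)
next
  show "symmetric (with_proj (cycle_graph n))"
    by (auto simp: symmetric_def sym_def cycle_graph_def)
qed (auto simp: cycle_graph_def)

end

theory Submission
  imports Defs
begin

text \<open>
  If all vertices have stress one, no geodesic is longer than two: the geodesics of length two are
  exactly the induced paths \<open>a v b\<close> (\<open>a\<close> and \<open>b\<close> distinct and nonadjacent), and every geodesic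
  through \<open>v\<close> contains one with middle vertex \<open>v\<close>. So if \<open>v\<close> has stress one, then there is exactly
  one such induced path, and it is the whole geodesic. Taken over all vertices of a connected
  graph, this implies that any two distinct nonadjacent vertices have a common neighbour
  (\<open>stress_regular_1_diameter_le2\<close>) and that every neighbourhood contains exactly one
  nonadjacent pair.

  The heart of the proof is that a neighbourhood then consists of nothing but its nonadjacent pair
  (\<open>unique_induced_path3_nbhd\<close>). Suppose that \<open>v\<close> has the nonadjacent neighbours \<open>a\<close>, \<open>b\<close> and a
  third neighbour \<open>c\<close>. By uniqueness at \<open>v\<close>, the vertex \<open>c\<close> is adjacent to \<open>a\<close> and \<open>b\<close>, so \<open>a c b\<close>
  is the induced path at \<open>c\<close>. A neighbour \<open>x\<close> of \<open>a\<close> other than \<open>v\<close> must be adjacent to \<open>v\<close>: if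
  not, then either \<open>x\<close> is adjacent to \<open>c\<close> and \<open>x c v\<close> is a second induced path at \<open>c\<close>, or \<open>x a v\<close>
  and \<open>x a c\<close> are two induced paths at \<open>a\<close>. Hence the ends of the induced path at \<open>a\<close> are
  nonadjacent neighbours of \<open>v\<close>, so they are \<open>a\<close> and \<open>b\<close>, although \<open>a\<close> is not adjacent to itself.

  The graph is therefore 2-regular and triangle-free, with any two vertices at distance at most
  two. Going one step beyond the two neighbours of a vertex exhausts the graph: the two further
  vertices reached coincide, which gives the 4-cycle, or are distinct and adjacent, which gives
  the 5-cycle. Conversely both cycles satisfy the local conditions, and these imply stress one.
\<close>

section \<open>Geodesics and induced paths on three vertices\<close>

definition induced_path3 :: "('a, 'b) pre_digraph \<Rightarrow> 'a \<Rightarrow> 'a \<Rightarrow> 'a \<Rightarrow> bool" where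
  "induced_path3 G a v b \<longleftrightarrow> a \<rightarrow>\<^bsub>G\<^esub> v \<and> v \<rightarrow>\<^bsub>G\<^esub> b \<and> a \<noteq> b \<and> \<not> a \<rightarrow>\<^bsub>G\<^esub> b"

lemma vwalk_append_shortcut:
  assumes "vwalk (xs @ a # v # b # ys) G" and "a \<rightarrow>\<^bsub>G\<^esub> b"
  shows "vwalk (xs @ a # b # ys) G"
  using assms
  by (induction xs rule: vwalk_arcs.induct) (auto simp: vwalk_def)

lemma internal_vert_split:
  assumes "v \<in> internal_verts p"
  obtains xs a b ys where "p = xs @ a # v # b # ys"
proof -
  obtain us vs where *: "butlast (tl p) = us @ v # vs"
    using assms by (auto simp: internal_verts_def in_set_conv_decomp)
  then have "tl p \<noteq> []" "p \<noteq> []" by auto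
  then have "p = hd p # us @ v # vs @ [last p]"
    by (metis * append.assoc append_Cons append_butlast_last_id last_tl list.exhaust_sel)
  moreover obtain xs a where "hd p # us = xs @ [a]" by (metis list.distinct(1) rev_exhaust)
  moreover obtain b ys where "vs @ [last p] = b # ys" by (metis Nil_is_append_conv list.exhaust)
  ultimately have "p = xs @ a # v # b # ys"
    by (metis append.assoc append_Cons append_Nil)
  then show thesis by (rule that)
qed

context graph
begin

lemma adj_sym: "u \<rightarrow>\<^bsub>G\<^esub> v \<longleftrightarrow> v \<rightarrow>\<^bsub>G\<^esub> u"
  using graph_symmetric by blast

lemma geodesic_induced_path3:
  assumes "induced_path3 G a v b"
  shows "geodesic [a, v, b] G"
proof -
  have "vpath [a, v, b] G"
    using assms adj_not_same adj_in_verts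
    by (auto simp: induced_path3_def vpath_def vwalk_def)
  moreover have "3 \<le> length q" if "vpath q G" "hd q = a" "last q = b" for q
  proof -
    have "q \<noteq> []" "q \<noteq> [x]" "q \<noteq> [x, y]" for x y
      using that assms by (auto simp: induced_path3_def vpath_def vwalk_def)
    then have "length q \<noteq> 0" "length q \<noteq> 1" "length q \<noteq> 2"
      by (auto simp: length_Suc_conv numeral_2_eq_2)
    then show ?thesis by linarith
  qed
  ultimately show ?thesis
    unfolding geodesic_def by fastforce
qed

text \<open>
  A chord between the two outer vertices would shorten the geodesic by one step.
\<close>

lemma geodesic_consecutive_induced:
  assumes "geodesic (xs @ a # v # b # ys) G"
  shows "induced_path3 G a v b"
proof -
  let ?p = "xs @ a # v # b # ys" and ?q = "xs @ a # b # ys"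
  have p: "vwalk ?p G" "distinct ?p"
    using assms by (auto simp: geodesic_def vpath_def)
  have "vwalk (a # v # b # ys) G"
    using vwalkI_append_r[OF _ p(1)] by simp
  then have "a \<rightarrow>\<^bsub>G\<^esub> v" "v \<rightarrow>\<^bsub>G\<^esub> b" by (auto simp: vwalk_def)
  moreover have "\<not> a \<rightarrow>\<^bsub>G\<^esub> b"
  proof
    assume "a \<rightarrow>\<^bsub>G\<^esub> b"
    then have "vpath ?q G"
      using vwalk_append_shortcut[OF p(1)] p(2) by (auto simp: vpath_def)
    moreover have "hd ?q = hd ?p" "last ?q = last ?p"
      by (cases xs; simp)+
    ultimately have "vwalk_length ?p \<le> vwalk_length ?q"
      using assms unfolding geodesic_def by blast
    then show False by simp
  qed
  ultimately show ?thesis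
    using p(2) by (auto simp: induced_path3_def)
qed

lemma stress_1_unique_geodesic:
  assumes "stress G v = 1"
  shows "\<exists>p. geodesic p G \<and> v \<in> internal_verts p \<and>
    (\<forall>q. geodesic q G \<and> v \<in> internal_verts q \<longrightarrow> q = p \<or> q = rev p)"
proof -
  let ?Q = "{{p, rev p} | p. geodesic p G \<and> v \<in> internal_verts p}"
  obtain S where S: "?Q = {S}"
    using assms unfolding stress_def by (rule card_1_singletonE)
  have "S \<in> ?Q" unfolding S by simp
  then obtain p where p: "S = {p, rev p}" "geodesic p G" "v \<in> internal_verts p"
    by blast
  have "q = p \<or> q = rev p" if q: "geodesic q G" "v \<in> internal_verts q" for q
  proof -
    have "{q, rev q} \<in> ?Q" using q by blast
    then have "{q, rev q} = {p, rev p}" unfolding S p(1) by simp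
    then show ?thesis by blast
  qed
  then show ?thesis using p(2,3) by blast
qed

text \<open>
  An induced path through \<open>v\<close> is itself a geodesic, so it coincides with the only geodesic
  through \<open>v\<close>; this fixes the length of that geodesic as well.
\<close>

lemma stress_1_unique_induced_path3:
  assumes "stress G v = 1"
  obtains a b where "induced_path3 G a v b"
    and "\<And>c d. induced_path3 G c v d \<Longrightarrow> {c, d} = {a, b}"
    and "\<And>q. geodesic q G \<Longrightarrow> v \<in> internal_verts q \<Longrightarrow> length q = 3"
proof -
  obtain p where p: "geodesic p G" "v \<in> internal_verts p"
    and uniq: "\<And>q. geodesic q G \<Longrightarrow> v \<in> internal_verts q \<Longrightarrow> q = p \<or> q = rev p"
    using stress_1_unique_geodesic[OF assms] by blast
  obtain xs a b ys where "p = xs @ a # v # b # ys"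
    using internal_vert_split[OF p(2)] .
  with p(1) have ab: "induced_path3 G a v b"
    using geodesic_consecutive_induced by simp
  have path: "[c, v, d] = p \<or> [c, v, d] = rev p" if "induced_path3 G c v d" for c d
    using uniq[OF geodesic_induced_path3[OF that]] by (simp add: internal_verts_def)
  have p_eq: "p = [a, v, b] \<or> p = [b, v, a]"
    using path[OF ab] by (metis append_Cons append_Nil rev.simps rev_rev_ident)
  have "{c, d} = {a, b}" if "induced_path3 G c v d" for c d
    using path[OF that] p_eq by auto
  moreover have "length q = 3" if "geodesic q G" "v \<in> internal_verts q" for q
    using uniq[OF that] p_eq by auto
  ultimately show thesis using that ab by blast
qed

end

section \<open>Stress one as a local condition\<close>

definition nonadjacent_pair_nbhd :: "('a, 'b) pre_digraph \<Rightarrow> 'a \<Rightarrow> 'a \<Rightarrow> 'a \<Rightarrow> bool" where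
  "nonadjacent_pair_nbhd G v a b \<longleftrightarrow> a \<noteq> b \<and> \<not> a \<rightarrow>\<^bsub>G\<^esub> b \<and> (\<forall>u. v \<rightarrow>\<^bsub>G\<^esub> u \<longleftrightarrow> u = a \<or> u = b)"

definition diameter_le2 :: "('a, 'b) pre_digraph \<Rightarrow> bool" where
  "diameter_le2 G \<longleftrightarrow>
     (\<forall>u \<in> verts G. \<forall>w \<in> verts G. u \<noteq> w \<and> \<not> u \<rightarrow>\<^bsub>G\<^esub> w \<longrightarrow> (\<exists>v. u \<rightarrow>\<^bsub>G\<^esub> v \<and> v \<rightarrow>\<^bsub>G\<^esub> w))"

context graph
begin

lemma reachable_imp_vwalk:
  assumes "u \<rightarrow>\<^sup>*\<^bsub>G\<^esub> w"
  shows "\<exists>p. vwalk p G \<and> hd p = u \<and> last p = w"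
  using assms
proof (induction rule: converse_reachable_induct)
  case base
  then show ?case
    using reachable_in_verts(2)[OF assms] by (intro exI[of _ "[w]"]) (auto simp: vwalk_def)
next
  case (step x y)
  then obtain p where "vwalk p G" "hd p = y" "last p = w" by blast
  then show ?case
    using step vwalk_wf_digraph_consI by (intro exI[of _ "x # p"]) (auto simp: vwalk_def)
qed

lemma connected_ex_geodesic:
  assumes "connected G" "u \<in> verts G" "w \<in> verts G"
  obtains p where "geodesic p G" "hd p = u" "last p = w"
proof -
  have "u \<rightarrow>\<^sup>*\<^bsub>G\<^esub> w"
    using symmetric_connected_imp_strongly_connected[OF sym_arcs assms(1)] assms(2,3)
    by (simp add: strongly_connected_def)
  then obtain p where "vpath p G" "hd p = u" "last p = w"
    using reachable_imp_vwalk vwalk_imp_ex_vpath by metis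
  then obtain p where "vpath p G \<and> hd p = u \<and> last p = w"
    "\<forall>q. vpath q G \<and> hd q = u \<and> last q = w \<longrightarrow> vwalk_length p \<le> vwalk_length q"
    using ex_has_least_nat[of "\<lambda>p. vpath p G \<and> hd p = u \<and> last p = w" p vwalk_length] by blast
  then show thesis using that by (auto simp: geodesic_def)
qed

text \<open>
  A shortest path between distinct nonadjacent vertices has an internal vertex, and a geodesic
  through a vertex of stress one has three vertices.
\<close>

lemma stress_regular_1_diameter_le2:
  assumes "connected G" "stress_regular 1 G"
  shows "diameter_le2 G"
  unfolding diameter_le2_def
proof (intro ballI impI, elim conjE)
  fix u w assume uw: "u \<in> verts G" "w \<in> verts G" "u \<noteq> w" "\<not> u \<rightarrow>\<^bsub>G\<^esub> w"
  obtain p where p: "geodesic p G" "hd p = u" "last p = w"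
    using connected_ex_geodesic[OF assms(1) uw(1,2)] .
  then have walk: "vwalk p G" by (auto simp: geodesic_def)
  have "p \<noteq> []" "\<And>x. p \<noteq> [x]" "\<And>x y. p \<noteq> [x, y]"
    using walk p uw by (auto simp: vwalk_def)
  then obtain v b ys where p_eq: "p = u # v # b # ys"
    using p(2) by (metis list.exhaust_sel)
  then have "v \<in> internal_verts p" "v \<in> verts G"
    using walk by (auto simp: internal_verts_def vwalk_def)
  then have "length p = 3"
    using assms(2) p(1) stress_1_unique_induced_path3
    unfolding stress_regular_def by metis
  then have "p = [u, v, w]" using p_eq p(3) by auto
  then show "\<exists>v. u \<rightarrow>\<^bsub>G\<^esub> v \<and> v \<rightarrow>\<^bsub>G\<^esub> w" using walk by (auto simp: vwalk_def)
qed

text \<open>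
  A third neighbour of \<open>v\<close> would force the neighbourhood of \<open>a\<close> into the closed neighbourhood of \<open>v\<close>,
  where the only nonadjacent pair contains \<open>a\<close> itself; then \<open>a\<close> could not be the middle of an
  induced path.
\<close>

lemma unique_induced_path3_nbhd:
  assumes ex: "\<And>v. v \<in> verts G \<Longrightarrow> \<exists>a b. induced_path3 G a v b"
    and uniq: "\<And>v a b c d. induced_path3 G a v b \<Longrightarrow> induced_path3 G c v d \<Longrightarrow> {c, d} = {a, b}"
    and avb: "induced_path3 G a v b"
  shows "nonadjacent_pair_nbhd G v a b"
proof -
  have ab: "v \<rightarrow>\<^bsub>G\<^esub> a" "v \<rightarrow>\<^bsub>G\<^esub> b" "a \<noteq> b" "\<not> a \<rightarrow>\<^bsub>G\<^esub> b"
    using avb adj_sym by (auto simp: induced_path3_def)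
  have irrefl: "\<not> x \<rightarrow>\<^bsub>G\<^esub> x" for x using adj_not_same by blast
  have False if c: "v \<rightarrow>\<^bsub>G\<^esub> c" "c \<noteq> a" "c \<noteq> b" for c
  proof -
    have "c \<rightarrow>\<^bsub>G\<^esub> a"
    proof (rule ccontr)
      assume "\<not> c \<rightarrow>\<^bsub>G\<^esub> a"
      then have "induced_path3 G c v a" using c ab adj_sym by (auto simp: induced_path3_def)
      from uniq[OF avb this] show False using c by auto
    qed
    moreover have "c \<rightarrow>\<^bsub>G\<^esub> b"
    proof (rule ccontr)
      assume "\<not> c \<rightarrow>\<^bsub>G\<^esub> b"
      then have "induced_path3 G c v b" using c ab adj_sym by (auto simp: induced_path3_def)
      from uniq[OF avb this] show False using c by auto
    qed
    ultimately have acb: "induced_path3 G a c b"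
      using ab adj_sym by (auto simp: induced_path3_def)
    \<comment> \<open>A neighbour of \<open>a\<close> outside the closed neighbourhood of \<open>v\<close> spoils uniqueness at \<open>c\<close> or at \<open>a\<close>.\<close>
    have nbhd_a: "x \<rightarrow>\<^bsub>G\<^esub> v" if x: "a \<rightarrow>\<^bsub>G\<^esub> x" "x \<noteq> v" for x
    proof (rule ccontr)
      assume nxv: "\<not> x \<rightarrow>\<^bsub>G\<^esub> v"
      show False
      proof (cases "x \<rightarrow>\<^bsub>G\<^esub> c")
        case True
        then have "induced_path3 G x c v"
          using nxv x c adj_sym by (auto simp: induced_path3_def)
        from uniq[OF acb this] have "v = a \<or> v = b" by blast
        then show False using ab irrefl by blast
      next
        case False
        then have "induced_path3 G x a v" "induced_path3 G x a c"
          using nxv x c ab \<open>c \<rightarrow>\<^bsub>G\<^esub> a\<close> adj_sym by (auto simp: induced_path3_def)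
        from uniq[OF this] have "v = c" by (auto simp: doubleton_eq_iff)
        then show False using c(1) irrefl by blast
      qed
    qed
    obtain p q where paq: "induced_path3 G p a q"
      using ex ab(1) adj_in_verts by blast
    then have "p \<noteq> v" "q \<noteq> v"
      using nbhd_a adj_sym by (auto simp: induced_path3_def)
    then have "induced_path3 G p v q"
      using paq nbhd_a adj_sym by (auto simp: induced_path3_def)
    from uniq[OF avb this] have "p = a \<or> q = a" by blast
    then show False
      using paq irrefl unfolding induced_path3_def by blast
  qed
  then show ?thesis
    using ab by (auto simp: nonadjacent_pair_nbhd_def)
qed

lemma stress_regular_1_nbhd:
  assumes "stress_regular 1 G" "v \<in> verts G"
  shows "\<exists>a b. nonadjacent_pair_nbhd G v a b"
proof -
  have ex: "\<exists>a b. induced_path3 G a v b" if "v \<in> verts G" for v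
    using assms(1) that stress_1_unique_induced_path3 unfolding stress_regular_def by metis
  have uniq: "{c, d} = {a, b}" if "induced_path3 G a v b" "induced_path3 G c v d" for v a b c d
  proof -
    have "v \<in> verts G" using that(1) adj_in_verts by (auto simp: induced_path3_def)
    then show ?thesis
      using assms(1) that stress_1_unique_induced_path3 unfolding stress_regular_def by metis
  qed
  obtain a b where "induced_path3 G a v b" using ex[OF assms(2)] by blast
  with ex uniq have "nonadjacent_pair_nbhd G v a b" by (rule unique_induced_path3_nbhd)
  then show ?thesis by blast
qed

lemma geodesic_length_le3:
  assumes "diameter_le2 G" "geodesic p G"
  shows "length p \<le> 3"
proof -
  have p: "vwalk p G" "distinct p" "p \<noteq> []"
    using assms(2) by (auto simp: geodesic_def vpath_def vwalk_def)
  then have ends: "hd p \<in> verts G" "last p \<in> verts G"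
    by (auto simp: vwalk_def)
  have short: "length p \<le> length q" if "vpath q G" "hd q = hd p" "last q = last p" for q
  proof -
    have "q \<noteq> []" using that by (auto simp: vpath_def vwalk_def)
    moreover have "vwalk_length p \<le> vwalk_length q"
      using assms(2) that unfolding geodesic_def by blast
    ultimately show ?thesis by (cases q) auto
  qed
  consider "hd p = last p" | "hd p \<rightarrow>\<^bsub>G\<^esub> last p" | v where "hd p \<noteq> last p" "hd p \<rightarrow>\<^bsub>G\<^esub> v" "v \<rightarrow>\<^bsub>G\<^esub> last p"
    using assms(1) ends unfolding diameter_le2_def by blast
  then show ?thesis
  proof cases
    case 1
    then show ?thesis using short[of "[hd p]"] vpath_self[OF ends(1)] by auto
  next
    case 2
    then show ?thesis using short[of "[hd p, last p]"] vpathI_arc by auto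
  next
    case 3
    then have "vpath [hd p, v, last p] G"
      using adj_not_same adj_in_verts by (auto simp: vpath_def vwalk_def)
    then show ?thesis using short[of "[hd p, v, last p]"] by auto
  qed
qed

text \<open>
  Geodesics have at most three vertices, so those through \<open>v\<close> are induced paths with middle
  vertex \<open>v\<close>, and their ends form the nonadjacent pair.
\<close>

lemma stress_1I:
  assumes "diameter_le2 G" "nonadjacent_pair_nbhd G v a b"
  shows "stress G v = 1"
proof -
  have avb: "induced_path3 G a v b"
    using assms(2) adj_sym by (auto simp: nonadjacent_pair_nbhd_def induced_path3_def)
  have "p = [a, v, b] \<or> p = [b, v, a]" if p: "geodesic p G" "v \<in> internal_verts p" for p
  proof -
    obtain xs c d ys where p_eq: "p = xs @ c # v # d # ys"
      using internal_vert_split[OF p(2)] .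
    then have "xs = []" "ys = []"
      using geodesic_length_le3[OF assms(1) p(1)] by auto
    moreover have "induced_path3 G c v d"
      using p(1) p_eq geodesic_consecutive_induced by simp
    ultimately show ?thesis
      using p_eq assms(2) adj_sym by (auto simp: induced_path3_def nonadjacent_pair_nbhd_def)
  qed
  moreover have "geodesic [a, v, b] G" "v \<in> internal_verts [a, v, b]"
    using geodesic_induced_path3[OF avb] by (auto simp: internal_verts_def)
  ultimately have "{{p, rev p} | p. geodesic p G \<and> v \<in> internal_verts p} = {{[a, v, b], [b, v, a]}}"
    by (fastforce simp: insert_commute)
  then show ?thesis by (simp add: stress_def)
qed

lemma stress_regular_1_iff:
  assumes "connected G"
  shows "stress_regular 1 G \<longleftrightarrow>
    diameter_le2 G \<and> (\<forall>v \<in> verts G. \<exists>a b. nonadjacent_pair_nbhd G v a b)"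
  using stress_regular_1_diameter_le2[OF assms] stress_regular_1_nbhd stress_1I
  unfolding stress_regular_def by blast

end

section \<open>Recognising the cycles\<close>

lemma All_less_4: "(\<forall>i<4. P i) \<longleftrightarrow> P 0 \<and> P 1 \<and> P 2 \<and> P (3::nat)"
  by (auto simp: less_Suc_eq numeral_eq_Suc)

lemma All_less_5: "(\<forall>i<5. P i) \<longleftrightarrow> P 0 \<and> P 1 \<and> P 2 \<and> P 3 \<and> P (4::nat)"
  by (auto simp: less_Suc_eq numeral_eq_Suc)

context graph
begin

text \<open>
  In the absence of parallel arcs an isomorphism is determined by its action on vertices, so it
  amounts to a listing of the vertices in cyclic order.
\<close>

lemma digraph_iso_cycle_graph_iff:
  "digraph_iso G (with_proj (cycle_graph n)) \<longleftrightarrow>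
    (\<exists>xs. length xs = n \<and> distinct xs \<and> set xs = verts G \<and>
      (\<forall>i<n. \<forall>j<n. xs ! i \<rightarrow>\<^bsub>G\<^esub> xs ! j \<longleftrightarrow> j = Suc i mod n \<or> i = Suc j mod n))"
  (is "?L \<longleftrightarrow> ?R")
proof
  assume ?L
  then obtain h where h: "digraph_isomorphism h" "with_proj (cycle_graph n) = app_iso h G"
    by (auto simp: digraph_iso_def)
  let ?f = "iso_verts h" and ?g = "the_inv_into (verts G) (iso_verts h)"
  have inj: "inj_on ?f (verts G)" using h(1) by (simp add: digraph_isomorphism_def)
  have "pverts (cycle_graph n) = ?f ` verts G"
    using arg_cong[OF h(2), of verts] by simp
  then have img: "?f ` verts G = {..<n}" by (simp add: cycle_graph_def)
  have bij: "bij_betw ?g {..<n} (verts G)"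
    using inj img bij_betw_the_inv_into by (metis bij_betw_def)
  have arcs: "parcs (cycle_graph n) = (\<lambda>(u, v). (?f u, ?f v)) ` arcs_ends G"
    using arcs_ends_app_iso_eq[OF h(1)] arg_cong[OF h(2), of arcs_ends] by simp
  have "?g i \<rightarrow>\<^bsub>G\<^esub> ?g j \<longleftrightarrow> j = Suc i mod n \<or> i = Suc j mod n" if "i < n" "j < n" for i j
  proof -
    have fg: "?f (?g i) = i" "?f (?g j) = j"
      using that inj img by (auto intro: f_the_inv_into_f)
    have "?g i \<rightarrow>\<^bsub>G\<^esub> ?g j \<longleftrightarrow> (i, j) \<in> parcs (cycle_graph n)"
    proof
      assume "?g i \<rightarrow>\<^bsub>G\<^esub> ?g j"
      then show "(i, j) \<in> parcs (cycle_graph n)" unfolding arcs using fg by force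
    next
      assume "(i, j) \<in> parcs (cycle_graph n)"
      then obtain u v where "u \<rightarrow>\<^bsub>G\<^esub> v" "i = ?f u" "j = ?f v" unfolding arcs by auto
      then show "?g i \<rightarrow>\<^bsub>G\<^esub> ?g j"
        using the_inv_into_f_f[OF inj] adj_in_verts by metis
    qed
    then show ?thesis using that by (simp add: cycle_graph_def)
  qed
  then show ?R
    using bij by (intro exI[of _ "map ?g [0..<n]"])
      (auto simp: distinct_map bij_betw_def atLeast0LessThan)
next
  assume ?R
  then obtain xs where xs: "length xs = n" "distinct xs" "set xs = verts G"
    and adj: "\<And>i j. i < n \<Longrightarrow> j < n \<Longrightarrow> xs ! i \<rightarrow>\<^bsub>G\<^esub> xs ! j \<longleftrightarrow> j = Suc i mod n \<or> i = Suc j mod n"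
    by blast
  have bij: "bij_betw ((!) xs) {..<n} (verts G)"
    using xs bij_betw_nth by blast
  define f where "f = the_inv_into {..<n} ((!) xs)"
  have fb: "bij_betw f (verts G) {..<n}"
    unfolding f_def using bij by (rule bij_betw_the_inv_into)
  have f_nth: "xs ! f v = v" "f v < n" if "v \<in> verts G" for v
    using that f_the_inv_into_f_bij_betw[OF bij] bij_betwE[OF fb] by (auto simp: f_def)
  define h where "h = \<lparr>iso_verts = f, iso_arcs = (\<lambda>e. (f (tail G e), f (head G e))),
    iso_head = snd, iso_tail = fst\<rparr>"
  have inj: "inj_on f (verts G)" using fb by (simp add: bij_betw_def)
  have "inj_on (iso_arcs h) (arcs G)"
  proof (rule inj_onI)
    fix d e assume "d \<in> arcs G" "e \<in> arcs G" "iso_arcs h d = iso_arcs h e"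
    then show "d = e"
      using inj by (intro no_multi_arcs) (auto simp: h_def arc_to_ends_def dest: inj_onD)
  qed
  then have "digraph_isomorphism h"
    using inj wf_digraph_axioms by (auto simp: digraph_isomorphism_def h_def)
  moreover have "with_proj (cycle_graph n) = app_iso h G"
  proof -
    have "(i, j) \<in> parcs (cycle_graph n) \<longleftrightarrow> (i, j) \<in> (\<lambda>e. (f (tail G e), f (head G e))) ` arcs G"
      for i j
    proof
      assume "(i, j) \<in> parcs (cycle_graph n)"
      then have ij: "i < n" "j < n" "xs ! i \<rightarrow>\<^bsub>G\<^esub> xs ! j" using adj by (auto simp: cycle_graph_def)
      then obtain e where "e \<in> arcs G" "tail G e = xs ! i" "head G e = xs ! j"
        by (auto simp: arcs_ends_conv)
      moreover have "f (xs ! k) = k" if "k < n" for k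
        unfolding f_def using that bij by (auto intro!: the_inv_into_f_f simp: bij_betw_def)
      ultimately show "(i, j) \<in> (\<lambda>e. (f (tail G e), f (head G e))) ` arcs G"
        using ij by force
    next
      assume "(i, j) \<in> (\<lambda>e. (f (tail G e), f (head G e))) ` arcs G"
      then obtain e where e: "e \<in> arcs G" "i = f (tail G e)" "j = f (head G e)" by auto
      then have "xs ! i \<rightarrow>\<^bsub>G\<^esub> xs ! j" "i < n" "j < n"
        using f_nth by (auto simp: in_arcs_imp_in_arcs_ends)
      then show "(i, j) \<in> parcs (cycle_graph n)" using adj by (auto simp: cycle_graph_def)
    qed
    then have "parcs (cycle_graph n) = (\<lambda>e. (f (tail G e), f (head G e))) ` arcs G" by auto
    moreover have "pverts (cycle_graph n) = f ` verts G"
      using fb by (simp add: cycle_graph_def bij_betw_def)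
    ultimately show ?thesis by (simp add: app_iso_def with_proj_def h_def)
  qed
  ultimately show ?L by (auto simp: digraph_iso_def)
qed

lemma nonadjacent_pair_nbhdI:
  assumes "\<exists>p q. nonadjacent_pair_nbhd G v p q" and "v \<rightarrow>\<^bsub>G\<^esub> a" "v \<rightarrow>\<^bsub>G\<^esub> b" "a \<noteq> b"
  shows "nonadjacent_pair_nbhd G v a b"
  using assms adj_sym unfolding nonadjacent_pair_nbhd_def by metis

text \<open>
  Start from a vertex \<open>v\<close> with neighbours \<open>a\<close> and \<open>b\<close>, and let \<open>x\<close> and \<open>y\<close> be the other neighbours
  of \<open>a\<close> and \<open>b\<close>. Every vertex lies within distance two of \<open>v\<close>, so these are all of them. If
  \<open>x \<noteq> y\<close>, a common neighbour of \<open>x\<close> and \<open>b\<close> can only be \<open>y\<close>, which closes the 5-cycle.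
\<close>

lemma diameter_le2_nbhds_imp_cycle:
  assumes diam: "diameter_le2 G" and nbhd: "\<forall>v \<in> verts G. \<exists>a b. nonadjacent_pair_nbhd G v a b"
    and "verts G \<noteq> {}"
  shows "digraph_iso G (with_proj (cycle_graph 4)) \<or> digraph_iso G (with_proj (cycle_graph 5))"
proof -
  have irrefl: "\<not> x \<rightarrow>\<^bsub>G\<^esub> x" for x using adj_not_same by blast
  have other: "\<exists>q. q \<noteq> p \<and> nonadjacent_pair_nbhd G u p q" if up: "u \<rightarrow>\<^bsub>G\<^esub> p" for u p
  proof -
    obtain c d where "nonadjacent_pair_nbhd G u c d" using nbhd adj_in_verts(1)[OF up] by blast
    then show ?thesis using up adj_sym unfolding nonadjacent_pair_nbhd_def by metis
  qed
  obtain v a b where v: "v \<in> verts G" "nonadjacent_pair_nbhd G v a b"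
    using nbhd assms(3) by blast
  then have va: "v \<rightarrow>\<^bsub>G\<^esub> a" "v \<rightarrow>\<^bsub>G\<^esub> b" "a \<noteq> b" "\<not> a \<rightarrow>\<^bsub>G\<^esub> b"
    by (auto simp: nonadjacent_pair_nbhd_def)
  obtain x where x: "x \<noteq> v" "nonadjacent_pair_nbhd G a v x" using other va(1) adj_sym by blast
  obtain y where y: "y \<noteq> v" "nonadjacent_pair_nbhd G b v y" using other va(2) adj_sym by blast
  have adj: "a \<rightarrow>\<^bsub>G\<^esub> x" "b \<rightarrow>\<^bsub>G\<^esub> y" "\<not> v \<rightarrow>\<^bsub>G\<^esub> x" "\<not> v \<rightarrow>\<^bsub>G\<^esub> y"
    using x y by (auto simp: nonadjacent_pair_nbhd_def)
  have in_verts: "{v, a, b, x, y} \<subseteq> verts G" using v adj va adj_in_verts by blast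
  have verts: "verts G = {v, a, b, x, y}"
  proof -
    have "w \<in> {v, a, b, x, y}" if w: "w \<in> verts G" for w
    proof (cases "w = v \<or> v \<rightarrow>\<^bsub>G\<^esub> w")
      case True
      then show ?thesis using v(2) by (auto simp: nonadjacent_pair_nbhd_def)
    next
      case False
      then obtain u where "v \<rightarrow>\<^bsub>G\<^esub> u" "u \<rightarrow>\<^bsub>G\<^esub> w"
        using diam v(1) w unfolding diameter_le2_def by metis
      then show ?thesis using v(2) x(2) y(2) by (auto simp: nonadjacent_pair_nbhd_def)
    qed
    then show ?thesis using in_verts by blast
  qed
  show ?thesis
  proof (cases "x = y")
    case True
    have "nonadjacent_pair_nbhd G x a b"
      using nbhd in_verts adj va True adj_sym by (intro nonadjacent_pair_nbhdI) auto
    moreover have "distinct [v, a, x, b]"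
      using x va adj True irrefl by auto
    ultimately have "digraph_iso G (with_proj (cycle_graph 4))"
      unfolding digraph_iso_cycle_graph_iff using verts True v(2) x(2) y(2)
      by (intro exI[of _ "[v, a, x, b]"])
        (auto simp: nonadjacent_pair_nbhd_def All_less_4)
    then show ?thesis ..
  next
    case False
    have dist: "distinct [v, a, x, y, b]"
      using x y va adj False irrefl adj_sym by auto
    have "\<not> b \<rightarrow>\<^bsub>G\<^esub> x" using y(2) x(1) False by (auto simp: nonadjacent_pair_nbhd_def)
    then obtain u where "x \<rightarrow>\<^bsub>G\<^esub> u" "u \<rightarrow>\<^bsub>G\<^esub> b"
      using diam in_verts dist adj_sym unfolding diameter_le2_def by (metis distinct_length_2_or_more insert_subset)
    then have xy: "x \<rightarrow>\<^bsub>G\<^esub> y"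
      using y(2) adj adj_sym unfolding nonadjacent_pair_nbhd_def by metis
    have "nonadjacent_pair_nbhd G x a y"
      using nbhd in_verts adj xy dist adj_sym by (intro nonadjacent_pair_nbhdI) auto
    moreover have "nonadjacent_pair_nbhd G y b x"
      using nbhd in_verts adj xy dist adj_sym by (intro nonadjacent_pair_nbhdI) auto
    ultimately have "digraph_iso G (with_proj (cycle_graph 5))"
      unfolding digraph_iso_cycle_graph_iff using verts dist v(2) x(2) y(2)
      by (intro exI[of _ "[v, a, x, y, b]"])
        (auto simp: nonadjacent_pair_nbhd_def All_less_5)
    then show ?thesis ..
  qed
qed

text \<open>
  With all quantifiers bounded by the vertex set, both conditions can be decided by going through
  an explicit list of vertices. This settles them for the 4-cycle and the 5-cycle.
\<close>

lemma diameter_le2_verts: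
  "diameter_le2 G \<longleftrightarrow> (\<forall>u \<in> verts G. \<forall>w \<in> verts G.
    u = w \<or> u \<rightarrow>\<^bsub>G\<^esub> w \<or> (\<exists>v \<in> verts G. u \<rightarrow>\<^bsub>G\<^esub> v \<and> v \<rightarrow>\<^bsub>G\<^esub> w))"
  unfolding diameter_le2_def using adj_in_verts by blast

lemma nonadjacent_pair_nbhd_verts:
  "(\<exists>a b. nonadjacent_pair_nbhd G v a b) \<longleftrightarrow>
    (\<exists>a \<in> verts G. \<exists>b \<in> verts G. a \<noteq> b \<and> \<not> a \<rightarrow>\<^bsub>G\<^esub> b \<and>
      (\<forall>u \<in> verts G. v \<rightarrow>\<^bsub>G\<^esub> u \<longleftrightarrow> u = a \<or> u = b))"
proof -
  have "nonadjacent_pair_nbhd G v a b \<longleftrightarrow> a \<in> verts G \<and> b \<in> verts G \<and> a \<noteq> b \<and>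
    \<not> a \<rightarrow>\<^bsub>G\<^esub> b \<and> (\<forall>u \<in> verts G. v \<rightarrow>\<^bsub>G\<^esub> u \<longleftrightarrow> u = a \<or> u = b)" for a b
    using adj_in_verts(2)[of v] by (auto simp: nonadjacent_pair_nbhd_def)
  then show ?thesis by blast
qed

lemma C4_imp_diameter_le2_nbhds:
  assumes "digraph_iso G (with_proj (cycle_graph 4))"
  shows "diameter_le2 G \<and> (\<forall>v \<in> verts G. \<exists>a b. nonadjacent_pair_nbhd G v a b)"
proof -
  obtain xs where xs: "length xs = 4" "distinct xs" "set xs = verts G"
    and adj: "\<forall>i<4. \<forall>j<4. xs ! i \<rightarrow>\<^bsub>G\<^esub> xs ! j \<longleftrightarrow> j = Suc i mod 4 \<or> i = Suc j mod 4"
    using assms unfolding digraph_iso_cycle_graph_iff by blast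
  obtain p q r s where "xs = [p, q, r, s]"
    using xs(1) by (auto simp: length_Suc_conv numeral_eq_Suc)
  with xs adj show ?thesis
    by (simp add: diameter_le2_verts nonadjacent_pair_nbhd_verts All_less_4 eq_commute[of _ "verts G"]) auto
qed

lemma C5_imp_diameter_le2_nbhds:
  assumes "digraph_iso G (with_proj (cycle_graph 5))"
  shows "diameter_le2 G \<and> (\<forall>v \<in> verts G. \<exists>a b. nonadjacent_pair_nbhd G v a b)"
proof -
  obtain xs where xs: "length xs = 5" "distinct xs" "set xs = verts G"
    and adj: "\<forall>i<5. \<forall>j<5. xs ! i \<rightarrow>\<^bsub>G\<^esub> xs ! j \<longleftrightarrow> j = Suc i mod 5 \<or> i = Suc j mod 5"
    using assms unfolding digraph_iso_cycle_graph_iff by blast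
  obtain p q r s t where "xs = [p, q, r, s, t]"
    using xs(1) by (auto simp: length_Suc_conv numeral_eq_Suc)
  with xs adj show ?thesis
    by (simp add: diameter_le2_verts nonadjacent_pair_nbhd_verts All_less_5 eq_commute[of _ "verts G"]) auto
qed

end

theorem theorem6p5:
  fixes G :: "('a, 'b) pre_digraph"
  assumes "Digraph.graph G"
    and "Digraph_Component.connected G"
  shows "stress_regular 1 G \<longleftrightarrow>
    digraph_iso G (with_proj (cycle_graph 4)) \<or> digraph_iso G (with_proj (cycle_graph 5))"
proof -
  interpret graph G by fact
  have "verts G \<noteq> {}" using assms(2) by (simp add: connected_conv)
  then show ?thesis
    unfolding stress_regular_1_iff[OF assms(2)]
    using diameter_le2_nbhds_imp_cycle C4_imp_diameter_le2_nbhds C5_imp_diameter_le2_nbhds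
    by blast
qed

end
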